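(* Let $\mathbf{U}=(U_1,\dots,U_p)^T$ be a $p$-dimensional random vector with $U_j\in[-1,1]$ for all $j$, and let $\phi_{\mathbf{U}}(\mathbf{t})=\mathbb{E}[\exp(i\mathbf{t}^T\mathbf{U})]$ be its characteristic function. Let $\{A_{j,d}\}$ be a general binary expansion of $\mathbf{U}$, with depth-$D$ binary approximation $\mathbf{U}_D$ and binary interactions $A_\Lambda$. For $\mathbf{t}=(t_1,\dots,t_p)^T\in\mathbb{R}^p$ and $\Lambda\in\mathbf{B}^{p\times D}$ put $$\Psi_\Lambda(\mathbf{t})=\prod_{j=1}^p\prod_{d=1}^D\{\cos(t_j/2^d)\}^{1-\Lambda_{jd}}\{i\sin(t_j/2^d)\}^{\Lambda_{jd}} .$$ Then for every $\mathbf{t}\in\mathbb{R}^p$ and every positive integer $D$, $$e^{i\mathbf{t}^T\mathbf{U}_D}=\sum_{\Lambda\in\mathbf{B}^{p\times D}}A_\Lambda\Psi_\Lambda(\mathbf{t}),$$ and for every $\mathbf{t}\in\mathbb{R}^p$, $$\phi_{\mathbf{U}}(\mathbf{t})=\lim_{D\to\infty}\sum_{\Lambda\in\mathbf{B}^{p\times D}}\Psi_\Lambda(\mathbf{t})\,\mathbb{E}[A_\Lambda].$$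
   Context: A general binary expansion of a random vector $\mathbf{U}=(U_1,\dots,U_p)^T$ supported within $[-1,1]^p$ is a family of random variables $A_{j,d}$ ($1\le j\le p$, $d\ge 1$), defined on the same probability space as $\mathbf{U}$ and taking only the values $-1$ and $1$, such that with $U_{j,D}=\sum_{d=1}^D A_{j,d}/2^d$ one has $\max_{1\le j\le p}|U_j-U_{j,D}|\to0$ uniformly as $D\to\infty$ (such a family always exists). The depth-$D$ binary approximation of $\mathbf{U}$ is $\mathbf{U}_D=(U_{1,D},\dots,U_{p,D})^T$. $\mathbf{B}^{p\times D}$ is the set of all $p\times D$ matrices with entries in $\{0,1\}$. For $\Lambda\in\mathbf{B}^{p\times D}$, $A_\Lambda=\prod_{j=1}^p\prod_{d=1}^D(A_{j,d})^{\Lambda_{jd}}$, so that $A_\Lambda=1$ for the zero matrix. Convention: $0^0=1$. *)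

theory Defs
  imports "HOL-Probability.Probability"
begin

(* HOL-Probability's char is restricted to measures on the real line;
   this is the analogue for random vectors. *)
definition char_fun :: "'a measure \<Rightarrow> ('a \<Rightarrow> real ^ 'p) \<Rightarrow> real ^ 'p \<Rightarrow> complex" where
  "char_fun M U t = (CLINT \<omega>|M. iexp (t \<bullet> U \<omega>))"

(* A j d is only used for d >= 1; the value of A j 0 is irrelevant throughout. *)
definition bin_approx :: "('p \<Rightarrow> nat \<Rightarrow> 'a \<Rightarrow> real) \<Rightarrow> nat \<Rightarrow> 'a \<Rightarrow> real ^ 'p" where
  "bin_approx A D \<omega> = (\<chi> j. \<Sum>d=1..D. A j d \<omega> / 2 ^ d)"

(* U is constrained to the cube only almost surely, so convergence is required uniformly
   off a null set. The case N = {} is uniform convergence on the whole sample space. *)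
definition general_binary_expansion ::
    "'a measure \<Rightarrow> ('a \<Rightarrow> real ^ 'p) \<Rightarrow> ('p \<Rightarrow> nat \<Rightarrow> 'a \<Rightarrow> real) \<Rightarrow> bool" where
  "general_binary_expansion M U A \<longleftrightarrow>
     (\<forall>j. \<forall>d\<ge>1. A j d \<in> borel_measurable M \<and> (\<forall>\<omega>\<in>space M. A j d \<omega> \<in> {-1, 1})) \<and>
     (\<exists>N\<in>null_sets M. uniform_limit (space M - N)
        (\<lambda>D \<omega>. MAX j. \<bar>U \<omega> $ j - bin_approx A D \<omega> $ j\<bar>) (\<lambda>\<omega>. 0) sequentially)"

(* Since D varies, a p x D matrix is a function on pairs (j, d) with d in {1..D};
   it is extensional, so distinct functions are distinct matrices. *)
definition binary_matrices :: "nat \<Rightarrow> ('p::finite \<times> nat \<Rightarrow> nat) set" where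
  "binary_matrices D = (UNIV \<times> {1..D}) \<rightarrow>\<^sub>E {0, 1}"

definition binary_interaction ::
    "('p::finite \<Rightarrow> nat \<Rightarrow> 'a \<Rightarrow> real) \<Rightarrow> nat \<Rightarrow> ('p \<times> nat \<Rightarrow> nat) \<Rightarrow> 'a \<Rightarrow> real" where
  "binary_interaction A D \<Lambda> \<omega> = (\<Prod>j\<in>UNIV. \<Prod>d=1..D. A j d \<omega> ^ \<Lambda> (j, d))"

definition Psi :: "nat \<Rightarrow> ('p::finite \<times> nat \<Rightarrow> nat) \<Rightarrow> real ^ 'p \<Rightarrow> complex" where
  "Psi D \<Lambda> t = (\<Prod>j\<in>UNIV. \<Prod>d=1..D.
     complex_of_real (cos (t $ j / 2 ^ d)) ^ (1 - \<Lambda> (j, d)) *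
     (\<i> * complex_of_real (sin (t $ j / 2 ^ d))) ^ \<Lambda> (j, d))"

end

(* For a sign a, Euler's formula reads exp(i x a) = cos x + a (i sin x). Multiplying these
   identities over all digits and distributing the product over the sum yields the expansion;
   dominated convergence then gives the limit of its expectation. *)
theory Submission
  imports Defs
begin

text \<open>Cosine is even and sine is odd, so a sign in the argument leaves cos unchanged and comes
  out of sin as a factor.\<close>

lemma iexp_sign:
  assumes "a \<in> {-1, 1::real}"
  shows "iexp (x * a) = complex_of_real (cos x) + complex_of_real a * (\<i> * complex_of_real (sin x))"
proof -
  have "iexp (x * a) = cis (x * a)"
    by (simp add: cis_conv_exp)
  then show ?thesis
    using assms by (auto simp: complex_eq_iff)
qed

lemma iexp_bin_approx:
  fixes A :: "'p::finite \<Rightarrow> nat \<Rightarrow> 'a \<Rightarrow> real"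
  assumes A: "\<And>j d. d \<ge> 1 \<Longrightarrow> A j d \<omega> \<in> {-1, 1}"
  shows "iexp (t \<bullet> bin_approx A D \<omega>) =
    (\<Sum>\<Lambda>\<in>binary_matrices D. complex_of_real (binary_interaction A D \<Lambda> \<omega>) * Psi D \<Lambda> t)"
proof -
  let ?I = "(UNIV :: 'p set) \<times> {1..D}"
  \<comment> \<open>The entry \<open>b\<close> selects one summand of the Euler identity at digit
    (j, d): \<open>b = 0\<close> leaves the cosine, \<open>b = 1\<close> the signed sine term.
    Written with powers, both cases have the shape of the factors in
    \<open>binary_interaction\<close> and \<open>Psi\<close>.\<close>
  define F where "F = (\<lambda>(j, d) b. complex_of_real (A j d \<omega>) ^ b *
    (complex_of_real (cos (t $ j / 2 ^ d)) ^ (1 - b) * (\<i> * complex_of_real (sin (t $ j / 2 ^ d))) ^ b))"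
  have "t \<bullet> bin_approx A D \<omega> = (\<Sum>(j, d)\<in>?I. t $ j / 2 ^ d * A j d \<omega>)"
    by (simp add: inner_vec_def bin_approx_def sum_distrib_left sum.cartesian_product)
  then have "iexp (t \<bullet> bin_approx A D \<omega>) = (\<Prod>(j, d)\<in>?I. iexp (t $ j / 2 ^ d * A j d \<omega>))"
    by (simp add: sum_distrib_left exp_sum case_prod_unfold)
  also have "\<dots> = (\<Prod>jd\<in>?I. \<Sum>b\<in>{0, 1::nat}. F jd b)"
  proof (rule prod.cong)
    fix jd assume "jd \<in> ?I"
    then obtain j d where "jd = (j, d)" "d \<ge> 1"
      by auto
    then show "(case jd of (j, d) \<Rightarrow> iexp (t $ j / 2 ^ d * A j d \<omega>)) = (\<Sum>b\<in>{0, 1}. F jd b)"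
      using iexp_sign[OF A, of d "t $ j / 2 ^ d" j] by (simp add: F_def)
  qed simp
  \<comment> \<open>Distributivity: expanding the product means choosing one bit for each pair (j,
    d), and such a choice is exactly an extensional function on \<open>?I\<close>, that is, a
    matrix.\<close>
  also have "\<dots> = (\<Sum>\<Lambda>\<in>binary_matrices D. \<Prod>jd\<in>?I. F jd (\<Lambda> jd))"
    unfolding binary_matrices_def by (rule prod_sum_PiE) auto
  also have "\<dots> = (\<Sum>\<Lambda>\<in>binary_matrices D. complex_of_real (binary_interaction A D \<Lambda> \<omega>) * Psi D \<Lambda> t)"
    by (simp add: binary_interaction_def Psi_def prod.cartesian_product F_def
        case_prod_unfold prod.distrib)
  finally show ?thesis .
qed

text \<open>A product of signs has absolute value 1, and bounded measurable functions are integrable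
  on a probability space. This permits exchanging the expectation with the finite sum over
  matrices.\<close>

lemma (in prob_space) integrable_binary_interaction:
  fixes A :: "'p::finite \<Rightarrow> nat \<Rightarrow> 'a \<Rightarrow> real"
  assumes "\<And>j d. d \<ge> 1 \<Longrightarrow> A j d \<in> borel_measurable M"
    and A: "\<And>j d \<omega>. d \<ge> 1 \<Longrightarrow> \<omega> \<in> space M \<Longrightarrow> A j d \<omega> \<in> {-1, 1}"
  shows "integrable M (binary_interaction A D \<Lambda>)"
proof (rule integrable_const_bound[where B = 1])
  show "AE \<omega> in M. norm (binary_interaction A D \<Lambda> \<omega>) \<le> 1"
  proof (rule AE_I2)
    fix \<omega> assume "\<omega> \<in> space M"
    then have "\<bar>A j d \<omega>\<bar> = 1" if "d \<ge> 1" for j d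
      using A[OF that, of \<omega> j] by auto
    then show "norm (binary_interaction A D \<Lambda> \<omega>) \<le> 1"
      by (simp add: binary_interaction_def abs_prod power_abs)
  qed
  \<comment> \<open>The eta-expanded form lets the definition, stated with its argument \<omega>, be
    unfolded.\<close>
  have "(\<lambda>\<omega>. binary_interaction A D \<Lambda> \<omega>) \<in> borel_measurable M"
    unfolding binary_interaction_def
    by (intro borel_measurable_prod borel_measurable_power assms(1)) auto
  then show "binary_interaction A D \<Lambda> \<in> borel_measurable M" .
qed

text \<open>Extracts from the uniform limit the almost sure pointwise convergence that dominated
  convergence asks for.\<close>

lemma AE_bin_approx_tendsto:
  fixes U :: "'a \<Rightarrow> real ^ 'p"
  assumes "general_binary_expansion M U A"
  shows "AE \<omega> in M. (\<lambda>D. bin_approx A D \<omega>) \<longlonglongrightarrow> U \<omega>"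
proof -
  from assms obtain N where N: "N \<in> null_sets M"
    and lim: "uniform_limit (space M - N)
        (\<lambda>D \<omega>. MAX j. \<bar>U \<omega> $ j - bin_approx A D \<omega> $ j\<bar>) (\<lambda>\<omega>. 0) sequentially"
    unfolding general_binary_expansion_def by blast
  show ?thesis
  \<comment> \<open>It suffices that the points of non-convergence lie inside \<open>N\<close>;
    their set need not be shown measurable.\<close>
  proof (rule AE_I'[OF N], rule subsetI, rule ccontr)
    fix \<omega> assume "\<omega> \<in> {\<omega> \<in> space M. \<not> (\<lambda>D. bin_approx A D \<omega>) \<longlonglongrightarrow> U \<omega>}" "\<omega> \<notin> N"
    then have \<omega>: "\<omega> \<in> space M - N" and *: "\<not> (\<lambda>D. bin_approx A D \<omega>) \<longlonglongrightarrow> U \<omega>"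
      by auto
    have "(\<lambda>D. MAX j. \<bar>U \<omega> $ j - bin_approx A D \<omega> $ j\<bar>) \<longlonglongrightarrow> 0"
      using tendsto_uniform_limitI[OF lim \<omega>] by simp
    \<comment> \<open>Each coordinate error is squeezed by the maximum over the finitely many
      coordinates.\<close>
    then have "(\<lambda>D. bin_approx A D \<omega> $ j - U \<omega> $ j) \<longlonglongrightarrow> 0" for j
      by (rule Lim_null_comparison[rotated])
        (auto intro!: always_eventually Max_ge simp: abs_minus_commute)
    then have "(\<lambda>D. bin_approx A D \<omega>) \<longlonglongrightarrow> U \<omega>"
      by (intro vec_tendstoI) (simp add: LIM_zero_iff)
    with * show False ..
  qed
qed

lemma (in prob_space) expectation_iexp_bin_approx_tendsto:
  fixes U :: "'a \<Rightarrow> real ^ 'p"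
  assumes [measurable]: "U \<in> borel_measurable M"
    and expansion: "general_binary_expansion M U A"
  shows "(\<lambda>D. CLINT \<omega>|M. iexp (t \<bullet> bin_approx A D \<omega>)) \<longlonglongrightarrow> char_fun M U t"
  unfolding char_fun_def
proof (rule integral_dominated_convergence[where w = "\<lambda>_. 1"])
  show "(\<lambda>\<omega>. iexp (t \<bullet> bin_approx A D \<omega>)) \<in> borel_measurable M" for D
  proof -
    have "(\<lambda>\<omega>. t \<bullet> bin_approx A D \<omega>) \<in> borel_measurable M"
      unfolding inner_vec_def bin_approx_def
      using expansion unfolding general_binary_expansion_def
      by (auto intro!: borel_measurable_sum borel_measurable_times borel_measurable_divide)
    then show ?thesis
      by measurable
  qed
  show "AE \<omega> in M. (\<lambda>D. iexp (t \<bullet> bin_approx A D \<omega>)) \<longlonglongrightarrow> iexp (t \<bullet> U \<omega>)"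
    using AE_bin_approx_tendsto[OF expansion] by eventually_elim (intro tendsto_intros)
\<comment> \<open>The dominating function is the constant 1: exp(ix) has modulus 1 for real x, and
  constants are integrable for a probability measure.\<close>
qed (auto simp: norm_exp_i_times)

theorem theorem2p2:
  fixes M :: "'a measure"
    and U :: "'a \<Rightarrow> real ^ 'p"
    and A :: "'p \<Rightarrow> nat \<Rightarrow> 'a \<Rightarrow> real"
  assumes "prob_space M"
    and "U \<in> borel_measurable M"
    and "AE \<omega> in M. \<forall>j. U \<omega> $ j \<in> {-1..1}"
    and "general_binary_expansion M U A"
  shows "(\<forall>t. \<forall>D\<ge>1. \<forall>\<omega>\<in>space M.
            iexp (t \<bullet> bin_approx A D \<omega>) =
              (\<Sum>\<Lambda>\<in>binary_matrices D.
                 complex_of_real (binary_interaction A D \<Lambda> \<omega>) * Psi D \<Lambda> t)) \<and>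
         (\<forall>t. (\<lambda>D. \<Sum>\<Lambda>\<in>binary_matrices D.
                 Psi D \<Lambda> t * complex_of_real (prob_space.expectation M (binary_interaction A D \<Lambda>)))
              \<longlonglongrightarrow> char_fun M U t)"
proof -
  interpret prob_space M by fact
  have A: "A j d \<in> borel_measurable M" "\<And>\<omega>. \<omega> \<in> space M \<Longrightarrow> A j d \<omega> \<in> {-1, 1}" if "d \<ge> 1" for j d
    using assms(4) that unfolding general_binary_expansion_def by auto
  have expand: "iexp (t \<bullet> bin_approx A D \<omega>) =
      (\<Sum>\<Lambda>\<in>binary_matrices D. complex_of_real (binary_interaction A D \<Lambda> \<omega>) * Psi D \<Lambda> t)"
    if "\<omega> \<in> space M" for t D \<omega>
    by (rule iexp_bin_approx) (use A that in auto)
  have "(CLINT \<omega>|M. iexp (t \<bullet> bin_approx A D \<omega>)) =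
      (\<Sum>\<Lambda>\<in>binary_matrices D. Psi D \<Lambda> t * complex_of_real (expectation (binary_interaction A D \<Lambda>)))"
    for t D
  proof -
    have int: "integrable M (binary_interaction A D \<Lambda>)" for \<Lambda>
      by (rule integrable_binary_interaction) (use A in auto)
    \<comment> \<open>The expansion is known only on \<open>space M\<close>, which is all that
      congruence of integrals requires.\<close>
    have "(CLINT \<omega>|M. iexp (t \<bullet> bin_approx A D \<omega>)) = (CLINT \<omega>|M. \<Sum>\<Lambda>\<in>binary_matrices D.
        complex_of_real (binary_interaction A D \<Lambda> \<omega>) * Psi D \<Lambda> t)"
      by (rule Bochner_Integration.integral_cong) (simp_all only: expand)
    also have "\<dots> = (\<Sum>\<Lambda>\<in>binary_matrices D.
        CLINT \<omega>|M. complex_of_real (binary_interaction A D \<Lambda> \<omega>) * Psi D \<Lambda> t)"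
      by (intro Bochner_Integration.integral_sum integrable_mult_left integrable_of_real int)
    finally show ?thesis
      by (simp add: mult.commute)
  qed
  \<comment> \<open>By the equality just shown, the sums over matrices are the characteristic
    functions of the approximations, whose limit is already known.\<close>
  then show ?thesis
    using expand expectation_iexp_bin_approx_tendsto[OF assms(2,4)] by simp
qed

end
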